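(* For any two finite fields $\mathbb{F}$ and $\mathbb{K}$ with different characteristics, there exists a network $\mathcal{N}$ whose linear rate regions over the two fields do not contain one another, i.e., $\mathcal{R}_{lin}(\mathcal{N},\mathbb{F})\not\subseteq\mathcal{R}_{lin}(\mathcal{N},\mathbb{K})$ and $\mathcal{R}_{lin}(\mathcal{N},\mathbb{K})\not\subseteq\mathcal{R}_{lin}(\mathcal{N},\mathbb{F})$.
   Context: A network is a finite directed acyclic multigraph, some of whose nodes are sources or receivers, with finitely many message vectors (say $m$ of them), each originating at a source node; each receiver demands a specified set of the message vectors. The inputs of a node are the message vectors originating at the node together with the vectors carried by its incoming edges. For integers $k_1,\dots,k_m\ge 0$ and $n\ge 1$, a $(k_1,\dots,k_m,n)$ code over a finite alphabet $\mathcal{A}$ (with $|\mathcal{A}|\ge 2$) lets the $i$th message vector range over $\mathcal{A}^{k_i}$, assigns to each edge an edge function mapping the inputs of the edge's tail node to a vector in $\mathcal{A}^n$ (the vector carried by the edge), and assigns to each receiver and each message vector it demands a decoding function of the receiver's inputs. The code is a solution if, for all values of the message vectors, each decoding function outputs the demanded message vector. Its rate vector is $(k_1/n,\dots,k_m/n)$. For a finite field $\mathbb{F}$, a $(k_1,\dots,k_m,n)$ code over the alphabet $\mathbb{F}$ is linear if every edge function and decoding function is of the form $\mathbf{x}\mapsto A\mathbf{x}$, where $\mathbf{x}$ is the concatenation of the input vectors of the node and $A$ is a matrix over $\mathbb{F}$. A rate vector $\mathbf{r}$ is linearly achievable for $\mathcal{N}$ over $\mathbb{F}$ if $\mathcal{N}$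 has a linear solution over $\mathbb{F}$ (for some block sizes $k_1,\dots,k_m,n$) with rate vector $\mathbf{r}$. The linear rate region is $\mathcal{R}_{lin}(\mathcal{N},\mathbb{F})=\{\mathbf{r}\in\mathbb{Q}^m : \mathbf{r}\text{ is linearly achievable for }\mathcal{N}\text{ over }\mathbb{F}\}$. *)

theory Defs
  imports "Graph_Theory.Digraph" "Jordan_Normal_Form.Matrix"
begin

section \<open>Networks\<close>

text \<open>Message vectors are indexed by \<open>0, \<dots>, m - 1\<close>, where \<open>m\<close> is \<open>num_msgs\<close>.\<close>

record ('v, 'e) network =
  graph :: "('v, 'e) pre_digraph"
  sources :: "'v set"
  receivers :: "'v set"
  num_msgs :: nat
  origin :: "nat \<Rightarrow> 'v"
  demands :: "'v \<Rightarrow> nat set"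

locale network =
  fixes N :: "('v, 'e) network"
  assumes finite_graph: "fin_digraph (graph N)"
    and acyclic_graph: "acyclic (arcs_ends (graph N))"
    and sources: "sources N \<subseteq> verts (graph N)"
    and receivers: "receivers N \<subseteq> verts (graph N)"
    and origin: "i < num_msgs N \<Longrightarrow> origin N i \<in> sources N"
    and demands: "v \<in> receivers N \<Longrightarrow> demands N v \<subseteq> {..<num_msgs N}"

text \<open>The inputs of a node are listed in a fixed order, first the messages originating there and
  then its incoming edges, each in increasing order.  The order on the edges only serves to make
  the concatenation of the inputs well defined.\<close>

definition node_msgs :: "('v, 'e) network \<Rightarrow> 'v \<Rightarrow> nat list" where
  "node_msgs N v = sorted_list_of_set {i. i < num_msgs N \<and> origin N i = v}"

definition node_in_arcs :: "('v, 'e::linorder) network \<Rightarrow> 'v \<Rightarrow> 'e list" where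
  "node_in_arcs N v = sorted_list_of_set {e \<in> arcs (graph N). head (graph N) e = v}"

definition inputs ::
  "('v, 'e::linorder) network \<Rightarrow> (nat \<Rightarrow> 'a vec) \<Rightarrow> ('e \<Rightarrow> 'a vec) \<Rightarrow> 'v \<Rightarrow> 'a vec list" where
  "inputs N w z v = map w (node_msgs N v) @ map z (node_in_arcs N v)"


section \<open>Codes and solutions\<close>

text \<open>The alphabet of a code is the whole type \<open>'a\<close>, and elements of \<open>carrier_vec d\<close> play the role
  of the words of length \<open>d\<close>; no algebraic structure on \<open>'a\<close> is involved.  In a
  \<open>(k\<^sub>1, \<dots>, k\<^sub>m, n)\<close> code, the \<open>k\<^sub>i\<close> are the values of \<open>msg_len\<close> and \<open>n\<close> is \<open>edge_len\<close>.\<close>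

record ('v, 'e, 'a) code =
  msg_len :: "nat \<Rightarrow> nat"
  edge_len :: nat
  edge_fun :: "'e \<Rightarrow> 'a vec list \<Rightarrow> 'a vec"
  dec_fun :: "'v \<Rightarrow> nat \<Rightarrow> 'a vec list \<Rightarrow> 'a vec"

definition input_lens ::
  "('v, 'e::linorder) network \<Rightarrow> ('v, 'e, 'a) code \<Rightarrow> 'v \<Rightarrow> nat list" where
  "input_lens N C v = map (msg_len C) (node_msgs N v) @ map (\<lambda>_. edge_len C) (node_in_arcs N v)"

definition input_space ::
  "('v, 'e::linorder) network \<Rightarrow> ('v, 'e, 'a) code \<Rightarrow> 'v \<Rightarrow> 'a vec list set" where
  "input_space N C v = listset (map carrier_vec (input_lens N C v))"

definition is_code :: "('v, 'e::linorder) network \<Rightarrow> ('v, 'e, 'a) code \<Rightarrow> bool" where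
  "is_code N C \<longleftrightarrow>
     edge_len C \<ge> 1 \<and>
     (\<forall>e \<in> arcs (graph N). \<forall>xs \<in> input_space N C (tail (graph N) e).
        edge_fun C e xs \<in> carrier_vec (edge_len C)) \<and>
     (\<forall>v \<in> receivers N. \<forall>i \<in> demands N v. \<forall>xs \<in> input_space N C v.
        dec_fun C v i xs \<in> carrier_vec (msg_len C i))"

definition messages :: "('v, 'e) network \<Rightarrow> ('v, 'e, 'a) code \<Rightarrow> (nat \<Rightarrow> 'a vec) set" where
  "messages N C = {w. \<forall>i < num_msgs N. w i \<in> carrier_vec (msg_len C i)}"

text \<open>By acyclicity, the vectors carried by the edges are determined by the messages; see
  \<open>carries_exists\<close> and \<open>carries_unique\<close> below.\<close>

definition carries ::
  "('v, 'e::linorder) network \<Rightarrow> ('v, 'e, 'a) code \<Rightarrow> (nat \<Rightarrow> 'a vec) \<Rightarrow> ('e \<Rightarrow> 'a vec) \<Rightarrow> bool" where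
  "carries N C w z \<longleftrightarrow>
     (\<forall>e \<in> arcs (graph N). z e = edge_fun C e (inputs N w z (tail (graph N) e)))"

definition is_solution :: "('v, 'e::linorder) network \<Rightarrow> ('v, 'e, 'a) code \<Rightarrow> bool" where
  "is_solution N C \<longleftrightarrow> is_code N C \<and>
     (\<forall>w \<in> messages N C. \<forall>z. carries N C w z \<longrightarrow>
        (\<forall>v \<in> receivers N. \<forall>i \<in> demands N v. dec_fun C v i (inputs N w z v) = w i))"

definition rate_vector :: "('v, 'e) network \<Rightarrow> ('v, 'e, 'a) code \<Rightarrow> rat vec" where
  "rate_vector N C = vec (num_msgs N) (\<lambda>i. of_nat (msg_len C i) / of_nat (edge_len C))"


section \<open>Linear codes and the linear rate region\<close>

definition concat_vec :: "'a::zero vec list \<Rightarrow> 'a vec" where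
  "concat_vec xs = foldr (@\<^sub>v) xs (0\<^sub>v 0)"

definition linear_on :: "nat list \<Rightarrow> nat \<Rightarrow> ('a::field vec list \<Rightarrow> 'a vec) \<Rightarrow> bool" where
  "linear_on ds r f \<longleftrightarrow>
     (\<exists>A \<in> carrier_mat r (sum_list ds). \<forall>xs \<in> listset (map carrier_vec ds).
        f xs = A *\<^sub>v concat_vec xs)"

definition is_linear_code :: "('v, 'e::linorder) network \<Rightarrow> ('v, 'e, 'a::field) code \<Rightarrow> bool" where
  "is_linear_code N C \<longleftrightarrow> is_code N C \<and>
     (\<forall>e \<in> arcs (graph N).
        linear_on (input_lens N C (tail (graph N) e)) (edge_len C) (edge_fun C e)) \<and>
     (\<forall>v \<in> receivers N. \<forall>i \<in> demands N v.
        linear_on (input_lens N C v) (msg_len C i) (dec_fun C v i))"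

definition linearly_achievable ::
  "('v, 'e::linorder) network \<Rightarrow> 'f::{field,finite} itself \<Rightarrow> rat vec \<Rightarrow> bool" where
  "linearly_achievable N F r \<longleftrightarrow>
     (\<exists>C :: ('v, 'e, 'f) code. is_linear_code N C \<and> is_solution N C \<and> rate_vector N C = r)"

definition linear_rate_region ::
  "('v, 'e::linorder) network \<Rightarrow> 'f::{field,finite} itself \<Rightarrow> rat vec set" where
  "linear_rate_region N F = {r \<in> carrier_vec (num_msgs N). linearly_achievable N F r}"


section \<open>Well-definedness of the carried vectors\<close>

context network
begin

definition arc_pred :: "('e \<times> 'e) set" where
  "arc_pred = {(e', e). e' \<in> arcs (graph N) \<and> e \<in> arcs (graph N) \<and>
     head (graph N) e' = tail (graph N) e}"

lemma wf_arc_pred: "wf arc_pred"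
proof -
  interpret fin_digraph "graph N" by (rule finite_graph)
  have "wf (arcs_ends (graph N))"
    using acyclic_graph by (intro finite_acyclic_wf) (auto simp: arcs_ends_def)
  then have "wf (inv_image (arcs_ends (graph N)) (tail (graph N)))"
    by (rule wf_inv_image)
  then show ?thesis
    by (rule wf_subset)
      (force simp: arc_pred_def inv_image_def arcs_ends_def arc_to_ends_def)
qed

end

lemma set_node_in_arcs:
  assumes "network N"
  shows "set (node_in_arcs N v) = {e \<in> arcs (graph N). head (graph N) e = v}"
proof -
  interpret fin_digraph "graph N" using assms by (rule network.finite_graph)
  show ?thesis by (simp add: node_in_arcs_def)
qed

lemma carries_exists:
  assumes "network N"
  shows "\<exists>z. carries N C w z"
proof -
  interpret network N by fact
  define H where "H = (\<lambda>z e. edge_fun C e (inputs N w z (tail (graph N) e)))"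
  have "wfrec arc_pred H e = H (wfrec arc_pred H) e" if "e \<in> arcs (graph N)" for e
  proof -
    have "inputs N w (cut (wfrec arc_pred H) arc_pred e) (tail (graph N) e) =
        inputs N w (wfrec arc_pred H) (tail (graph N) e)"
      using that by (auto simp: inputs_def set_node_in_arcs[OF assms] cut_def arc_pred_def)
    then show ?thesis
      by (subst wfrec[OF wf_arc_pred]) (simp add: H_def)
  qed
  then show ?thesis by (auto simp: carries_def H_def)
qed

lemma carries_unique:
  assumes "network N" "carries N C w z" "carries N C w z'" "e \<in> arcs (graph N)"
  shows "z e = z' e"
proof -
  interpret network N by fact
  show ?thesis
    using assms(4)
  proof (induction e rule: wf_induct_rule[OF wf_arc_pred])
    case (1 e)
    then have "inputs N w z (tail (graph N) e) = inputs N w z' (tail (graph N) e)"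
      by (auto simp: inputs_def set_node_in_arcs[OF assms(1)] arc_pred_def)
    then show ?case using assms(2,3) 1(2) by (simp add: carries_def)
  qed
qed

end

theory Submission
  imports Defs "HOL-Library.Nat_Bijection" "HOL-Computational_Algebra.Primes"
begin

text \<open>Fix messages \<open>x\<^sub>0, \<dots>, x\<^sub>M\<^sub>-\<^sub>1\<close>, an edge \<open>e\<^sub>M\<close> that sees all of them, and
  edges \<open>e\<^sub>i\<close> that see all of them but \<open>x\<^sub>i\<close>.  Require \<open>x\<^sub>i\<close> to be decodable from \<open>e\<^sub>i\<close> and \<open>e\<^sub>M\<close>, and,
  for each block \<open>S\<close> of a partition of the messages, all of \<open>(x\<^sub>i)\<^sub>i\<^sub>\<in>\<^sub>S\<close> to be decodable from
  \<open>(e\<^sub>i)\<^sub>i\<^sub>\<in>\<^sub>S\<close>.  Consider the rate vector that is \<open>1\<close> on \<open>S\<close> and \<open>0\<close> elsewhere.  Up to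
  changes of coordinates a linear solution must have \<open>e\<^sub>M = s = \<Sum>\<^sub>j x\<^sub>j\<close> and \<open>e\<^sub>i = s - x\<^sub>i\<close>, and
  these \<open>e\<^sub>i\<close> determine the messages in \<open>S\<close> if and only if \<open>|S| - 1 \<noteq> 0\<close> in the field: their sum is
  \<open>(|S| - 1) s\<close>, and if this vanishes then all \<open>e\<^sub>i\<close> vanish at \<open>(u, \<dots>, u)\<close>.  Blocks of sizes
  \<open>p + 1\<close> and \<open>q + 1\<close>, for the two characteristics \<open>p\<close> and \<open>q\<close>, give the two non-inclusions.\<close>

section \<open>Inputs and linear maps\<close>

lemma mem_listset_iff: "xs \<in> listset As \<longleftrightarrow> list_all2 (\<in>) xs As"
proof (induction As arbitrary: xs)
  case (Cons A As)
  then show ?case by (cases xs) (auto simp: set_Cons_def)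
qed simp

lemma set_node_msgs: "set (node_msgs N v) = {i. i < num_msgs N \<and> origin N i = v}"
  by (simp add: node_msgs_def)

lemma inputs_cong:
  assumes "network N"
    and "\<And>i. i < num_msgs N \<Longrightarrow> origin N i = v \<Longrightarrow> w i = w' i"
    and "\<And>e. e \<in> arcs (graph N) \<Longrightarrow> head (graph N) e = v \<Longrightarrow> z e = z' e"
  shows "inputs N w z v = inputs N w' z' v"
  using assms by (auto simp: inputs_def set_node_msgs set_node_in_arcs)

lemma inputs_in_input_space:
  assumes "network N" "w \<in> messages N C"
    and "\<And>e. e \<in> arcs (graph N) \<Longrightarrow> head (graph N) e = v \<Longrightarrow> z e \<in> carrier_vec (edge_len C)"
  shows "inputs N w z v \<in> input_space N C v"
  using assms
  by (auto simp: inputs_def input_space_def input_lens_def mem_listset_iff list_all2_map1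
      list_all2_map2 list_all2_same set_node_msgs set_node_in_arcs messages_def
      intro!: list_all2_appendI)

lemma carries_cong:
  assumes "network N" "carries N C w z" "carries N C w' z'" "e \<in> arcs (graph N)"
    and "\<And>i. i < num_msgs N \<Longrightarrow> origin N i = tail (graph N) e \<Longrightarrow> w i = w' i"
    and "\<And>e'. e' \<in> arcs (graph N) \<Longrightarrow> head (graph N) e' = tail (graph N) e \<Longrightarrow> z e' = z' e'"
  shows "z e = z' e"
  using assms inputs_cong[OF assms(1) assms(5,6)] by (simp add: carries_def)

text \<open>Induction along edges, since a code promises outputs of the right length only for inputs
  of the right length.\<close>

lemma carries_carrier:
  assumes "network N" "is_code N C" "w \<in> messages N C" "carries N C w z" "e \<in> arcs (graph N)"
  shows "z e \<in> carrier_vec (edge_len C)"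
proof -
  interpret network N by fact
  show ?thesis
    using assms(5)
  proof (induction e rule: wf_induct_rule[OF wf_arc_pred])
    case (1 e)
    then have "inputs N w z (tail (graph N) e) \<in> input_space N C (tail (graph N) e)"
      by (intro inputs_in_input_space assms) (auto simp: arc_pred_def)
    then show ?case using assms(2,4) 1(2) by (simp add: carries_def is_code_def)
  qed
qed

section \<open>Additivity of linear codes\<close>

lemma concat_vec_carrier:
  "xs \<in> listset (map carrier_vec ds) \<Longrightarrow> concat_vec xs \<in> carrier_vec (sum_list ds)"
proof (induction ds arbitrary: xs)
  case (Cons d ds)
  then show ?case by (auto simp: set_Cons_def concat_vec_def)
qed (simp add: concat_vec_def)

lemma concat_vec_add:
  fixes xs ys :: "'a::field vec list"
  assumes "xs \<in> listset (map carrier_vec ds)" "ys \<in> listset (map carrier_vec ds)"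
  shows "concat_vec (map2 (+) xs ys) = concat_vec xs + concat_vec ys"
  using assms
proof (induction ds arbitrary: xs ys)
  case (Cons d ds)
  then obtain x xs' y ys' where *: "xs = x # xs'" "ys = y # ys'"
    "x \<in> carrier_vec d" "y \<in> carrier_vec d"
    "xs' \<in> listset (map carrier_vec ds)" "ys' \<in> listset (map carrier_vec ds)"
    by (auto simp: set_Cons_def)
  have "concat_vec (map2 (+) xs' ys') = concat_vec xs' + concat_vec ys'"
    using * Cons.IH by blast
  then show ?case
    using * append_vec_add[OF *(3,4) concat_vec_carrier[OF *(5)] concat_vec_carrier[OF *(6)]]
    by (simp add: concat_vec_def)
qed (auto simp: concat_vec_def)

lemma listset_add:
  fixes xs ys :: "'a::field vec list"
  assumes "xs \<in> listset (map carrier_vec ds)" "ys \<in> listset (map carrier_vec ds)"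
  shows "map2 (+) xs ys \<in> listset (map carrier_vec ds)"
  using assms
proof (induction ds arbitrary: xs ys)
  case (Cons d ds)
  then show ?case by (fastforce simp: set_Cons_def)
qed auto

lemma linear_on_add:
  assumes "linear_on ds r f" "xs \<in> listset (map carrier_vec ds)" "ys \<in> listset (map carrier_vec ds)"
  shows "f (map2 (+) xs ys) = f xs + f ys"
proof -
  obtain A where A: "A \<in> carrier_mat r (sum_list ds)"
    "\<And>xs. xs \<in> listset (map carrier_vec ds) \<Longrightarrow> f xs = A *\<^sub>v concat_vec xs"
    using assms(1) by (auto simp: linear_on_def)
  show ?thesis
    using A(2) listset_add[OF assms(2,3)] assms(2,3)
      mult_add_distrib_mat_vec[OF A(1) concat_vec_carrier[OF assms(2)] concat_vec_carrier[OF assms(3)]]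
    by (simp add: concat_vec_add[OF assms(2,3)])
qed

lemma inputs_add:
  "inputs N (\<lambda>i. w i + w' i) (\<lambda>e. z e + z' e) v = map2 (+) (inputs N w z v) (inputs N w' z' v)"
  by (simp add: inputs_def map2_map_map)

text \<open>The impossibility proof uses linearity in this form.\<close>

lemma carries_add:
  assumes N: "network N" and C: "is_linear_code N C"
    and w: "w \<in> messages N C" "w' \<in> messages N C"
    and z: "carries N C w z" "carries N C w' z'"
  shows "carries N C (\<lambda>i. w i + w' i) (\<lambda>e. z e + z' e)"
proof -
  have code: "is_code N C" using C by (simp add: is_linear_code_def)
  show ?thesis
    unfolding carries_def
  proof
    fix e assume e: "e \<in> arcs (graph N)"
    let ?v = "tail (graph N) e"
    have lin: "linear_on (input_lens N C ?v) (edge_len C) (edge_fun C e)"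
      using C e by (simp add: is_linear_code_def)
    have "inputs N w z ?v \<in> input_space N C ?v" "inputs N w' z' ?v \<in> input_space N C ?v"
      using carries_carrier[OF N code] w z by (auto intro!: inputs_in_input_space N)
    then have "edge_fun C e (inputs N (\<lambda>i. w i + w' i) (\<lambda>e. z e + z' e) ?v) =
        edge_fun C e (inputs N w z ?v) + edge_fun C e (inputs N w' z' ?v)"
      unfolding inputs_add input_space_def by (rule linear_on_add[OF lin])
    then show "z e + z' e = edge_fun C e (inputs N (\<lambda>i. w i + w' i) (\<lambda>e. z e + z' e) ?v)"
      using z e by (simp add: carries_def)
  qed
qed

section \<open>Scalar linear combinations\<close>

text \<open>Meant for vectors of length 0 or 1: it reads off the single entry and gives 0 on the
  empty vector, so messages of rate 0 and 1 are treated alike.\<close>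

definition vec_sum :: "'a::comm_monoid_add vec \<Rightarrow> 'a" where
  "vec_sum x = (\<Sum>i<dim_vec x. x $ i)"

definition comb :: "nat \<Rightarrow> 'a::semiring_0 list \<Rightarrow> 'a vec list \<Rightarrow> 'a vec" where
  "comb r cs xs = vec r (\<lambda>_. sum_list (map2 (*) cs (map vec_sum xs)))"

lemma comb_carrier [simp]: "comb r cs xs \<in> carrier_vec r"
  by (simp add: comb_def)

lemma linear_on_comb:
  fixes cs :: "'a::field list"
  assumes "length cs = length ds"
  shows "linear_on ds r (comb r cs)"
proof -
  have "\<exists>a. \<forall>xs \<in> listset (map carrier_vec ds).
      sum_list (map2 (*) cs (map vec_sum xs)) = (\<Sum>l<sum_list ds. a l * concat_vec xs $ l)"
    using assms
  proof (induction cs ds rule: list_induct2)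
    case (Cons c cs d ds)
    then obtain a where a: "\<And>xs. xs \<in> listset (map carrier_vec ds) \<Longrightarrow>
        sum_list (map2 (*) cs (map vec_sum xs)) = (\<Sum>l<sum_list ds. a l * concat_vec xs $ l)"
      by blast
    \<comment> \<open>The matrix row repeats \<open>c\<close> on the \<open>d\<close> entries of the
      first input and continues with the shifted row of the remaining inputs.\<close>
    define a' where "a' = (\<lambda>l. if l < d then c else a (l - d))"
    have "sum_list (map2 (*) (c # cs) (map vec_sum (x # xs))) =
        (\<Sum>l<sum_list (d # ds). a' l * concat_vec (x # xs) $ l)"
      if x: "x \<in> carrier_vec d" and xs: "xs \<in> listset (map carrier_vec ds)" for x xs
    proof -
      have len: "dim_vec (foldr (@\<^sub>v) xs (0\<^sub>v 0)) = sum_list ds"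
        using concat_vec_carrier[OF xs] by (simp add: concat_vec_def)
      have split: "(\<Sum>l<m + m'. g l) = (\<Sum>l<m. g l) + (\<Sum>l<m'. g (l + m))"
        for g :: "nat \<Rightarrow> 'a" and m m' :: nat
        by (induction m') (simp_all add: ac_simps)
      have "(\<Sum>l<sum_list (d # ds). a' l * concat_vec (x # xs) $ l) =
          (\<Sum>l<d. a' l * concat_vec (x # xs) $ l) +
          (\<Sum>l<sum_list ds. a' (l + d) * concat_vec (x # xs) $ (l + d))"
        using split[of _ d "sum_list ds"] by simp
      also have "\<dots> = c * vec_sum x + (\<Sum>l<sum_list ds. a l * concat_vec xs $ l)"
        using x len by (simp add: a'_def concat_vec_def vec_sum_def sum_distrib_left)
      finally show ?thesis using a[OF xs] by simp
    qed
    then show ?case by (intro exI[of _ a']) (auto simp: set_Cons_def)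
  qed (simp add: exI)
  then obtain a where a: "\<And>xs. xs \<in> listset (map carrier_vec ds) \<Longrightarrow>
      sum_list (map2 (*) cs (map vec_sum xs)) = (\<Sum>l<sum_list ds. a l * concat_vec xs $ l)"
    by blast
  show ?thesis
    unfolding linear_on_def
  proof (intro bexI ballI)
    show "mat r (sum_list ds) (\<lambda>(i, l). a l) \<in> carrier_mat r (sum_list ds)" by simp
    fix xs :: "'a vec list" assume xs: "xs \<in> listset (map carrier_vec ds)"
    show "comb r cs xs = mat r (sum_list ds) (\<lambda>(i, l). a l) *\<^sub>v concat_vec xs"
      using concat_vec_carrier[OF xs]
      by (intro eq_vecI) (auto simp: comb_def a[OF xs] scalar_prod_def atLeast0LessThan)
  qed
qed

text \<open>Coefficient 1 suffices for messages: in the network below they originate only at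
  \<open>src\<close> nodes, which just forward them.\<close>

definition coefs :: "('v, 'e::linorder) network \<Rightarrow> 'v \<Rightarrow> ('e \<Rightarrow> 'a::one) \<Rightarrow> 'a list" where
  "coefs N v a = map (\<lambda>_. 1) (node_msgs N v) @ map a (node_in_arcs N v)"

lemma comb_coefs_inputs:
  fixes a :: "'e::linorder \<Rightarrow> 'a::field"
  assumes "network N"
  shows "comb r (coefs N v a) (inputs N w z v) = vec r (\<lambda>_.
    (\<Sum>i | i < num_msgs N \<and> origin N i = v. vec_sum (w i)) +
    (\<Sum>e | e \<in> arcs (graph N) \<and> head (graph N) e = v. a e * vec_sum (z e)))"
proof -
  have "sum_list (map2 (*) (coefs N v a) (map vec_sum (inputs N w z v))) =
      (\<Sum>i\<leftarrow>node_msgs N v. vec_sum (w i)) + (\<Sum>e\<leftarrow>node_in_arcs N v. a e * vec_sum (z e))"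
    by (simp add: coefs_def inputs_def map2_map_map comp_def)
  also have "\<dots> = (\<Sum>i\<in>set (node_msgs N v). vec_sum (w i)) +
      (\<Sum>e\<in>set (node_in_arcs N v). a e * vec_sum (z e))"
    by (simp add: sum_list_distinct_conv_sum_set node_msgs_def node_in_arcs_def)
  finally show ?thesis
    using assms by (simp add: comb_def set_node_msgs set_node_in_arcs)
qed

section \<open>An obstruction for additive maps\<close>

definition single :: "(nat \<Rightarrow> nat) \<Rightarrow> nat \<Rightarrow> 'a::zero vec \<Rightarrow> nat \<Rightarrow> 'a vec" where
  "single k j x = (\<lambda>i. if i = j then x else 0\<^sub>v (k i))"

lemma eq_zero_vecI:
  fixes a :: "'a::ab_group_add vec"
  assumes "a \<in> carrier_vec n" "x \<in> carrier_vec n" "a + x = a"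
  shows "x = 0\<^sub>v n"
proof (intro eq_vecI)
  fix i assume "i < dim_vec (0\<^sub>v n :: 'a vec)"
  then have "(a + x) $ i = a $ i + x $ i" "i < n" using assms(2) by auto
  then show "x $ i = 0\<^sub>v n $ i" using assms(3) by simp
qed (use assms in auto)

text \<open>Below, \<open>A j\<close> is the dependence of \<open>E M\<close> on the message \<open>j\<close>; it is injective, hence bijective by
  finiteness, which replaces the change of coordinates.  The message vector \<open>w S\<close>, with
  \<open>A j (w S j) = u\<close> for all \<open>j\<close>, corresponds to \<open>(u, \<dots>, u)\<close>.\<close>

lemma card_ne_one_of_additive:
  fixes k :: "nat \<Rightarrow> nat" and E :: "nat \<Rightarrow> (nat \<Rightarrow> 'a::{field,finite} vec) \<Rightarrow> 'a vec"
  defines "W \<equiv> {w. \<forall>i. w i \<in> carrier_vec (k i)}"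
  assumes S: "finite S" "2 \<le> card S" and n: "1 \<le> n" and k: "\<And>i. i \<in> S \<Longrightarrow> k i = n"
    and carrier: "\<And>i w. i \<in> insert M S \<Longrightarrow> w \<in> W \<Longrightarrow> E i w \<in> carrier_vec n"
    and add: "\<And>i w w'. i \<in> insert M S \<Longrightarrow> w \<in> W \<Longrightarrow> w' \<in> W \<Longrightarrow> E i (\<lambda>j. w j + w' j) = E i w + E i w'"
    and indep: "\<And>i w w'. i \<in> S \<Longrightarrow> w \<in> W \<Longrightarrow> w' \<in> W \<Longrightarrow> (\<And>j. j \<noteq> i \<Longrightarrow> w j = w' j) \<Longrightarrow> E i w = E i w'"
    and dec1: "\<And>i w w'. i \<in> S \<Longrightarrow> w \<in> W \<Longrightarrow> w' \<in> W \<Longrightarrow> E i w = E i w' \<Longrightarrow> E M w = E M w' \<Longrightarrow> w i = w' i"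
    and dec2: "\<And>i w w'. i \<in> S \<Longrightarrow> w \<in> W \<Longrightarrow> w' \<in> W \<Longrightarrow> (\<And>j. j \<in> S \<Longrightarrow> E j w = E j w') \<Longrightarrow> w i = w' i"
  shows "(of_nat (card S) :: 'a) \<noteq> 1"
proof
  \<comment> \<open>Under this assumption the nonzero tuple \<open>w S\<close> has
    \<open>E i\<close> equal to 0 for all \<open>i\<close> in \<open>S\<close>, so
    \<open>dec2\<close> cannot tell it from the zero tuple.\<close>
  assume one: "(of_nat (card S) :: 'a) = 1"
  let ?V = "carrier_vec n :: 'a vec set"
  have finV: "finite ?V"
  proof -
    have "?V \<subseteq> vec_of_list ` {xs. set xs \<subseteq> UNIV \<and> length xs = n}"
    proof
      fix x :: "'a vec" assume "x \<in> ?V"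
      then show "x \<in> vec_of_list ` {xs. set xs \<subseteq> UNIV \<and> length xs = n}"
        by (intro image_eqI[of _ _ "list_of_vec x"]) (auto simp: vec_list)
    qed
    then show ?thesis
      by (rule finite_subset) (intro finite_imageI finite_lists_length_eq finite_UNIV)
  qed
  have surj: "f ` ?V = ?V" if "f ` ?V \<subseteq> ?V" "inj_on f ?V" for f
    using that finV by (rule endo_inj_surj[rotated])
  have sW: "single k j x \<in> W" if "j \<in> S" "x \<in> ?V" for j x
    using that k by (auto simp: W_def single_def)
  have addW: "(\<lambda>j. w j + w' j) \<in> W" if "w \<in> W" "w' \<in> W" for w w'
    using that by (auto simp: W_def)
  have zW: "(\<lambda>j. 0\<^sub>v (k j)) \<in> W" by (simp add: W_def)
  have E0: "E i (\<lambda>j. 0\<^sub>v (k j)) = 0\<^sub>v n" if "i \<in> insert M S" for i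
  proof -
    let ?e = "E i (\<lambda>j. 0\<^sub>v (k j))"
    have e: "?e \<in> ?V" using carrier that zW by blast
    have "?e = ?e + ?e" using add[OF that zW zW] by simp
    then show ?thesis using eq_zero_vecI[OF e e] by simp
  qed
  define A where "A = (\<lambda>j x. E M (single k j x))"
  have A: "A j x \<in> ?V" if "j \<in> S" "x \<in> ?V" for j x
    using carrier sW that by (simp add: A_def)
  have A_zero: "A j (0\<^sub>v n) = 0\<^sub>v n" if "j \<in> S" for j
  proof -
    have "single k j (0\<^sub>v n :: 'a vec) = (\<lambda>j. 0\<^sub>v (k j))"
      using k[OF that] by (auto simp: single_def)
    then show ?thesis using E0[of M] by (simp add: A_def)
  qed
  \<comment> \<open>\<open>E j\<close> ignores message \<open>j\<close>, so \<open>dec1\<close> must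
    recover that message from \<open>E M\<close>.\<close>
  have A_inj: "inj_on (A j) ?V" if j: "j \<in> S" for j
  proof (rule inj_onI)
    fix x y assume xy: "x \<in> ?V" "y \<in> ?V" "A j x = A j y"
    have "E j (single k j x) = E j (single k j y)"
      by (rule indep[OF j sW[OF j xy(1)] sW[OF j xy(2)]]) (simp add: single_def)
    then have "single k j x j = single k j y j"
      by (rule dec1[OF j sW[OF j xy(1)] sW[OF j xy(2)]]) (use xy in \<open>simp add: A_def\<close>)
    then show "x = y" by (simp add: single_def)
  qed
  have A_surj: "\<exists>x\<in>?V. A j x = y" if j: "j \<in> S" and y: "y \<in> ?V" for j y
  proof -
    have "A j ` ?V = ?V" using A[OF j] A_inj[OF j] by (intro surj) auto
    then show ?thesis using y by (metis imageE)
  qed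
  \<comment> \<open>Message \<open>i\<close> can thus be used to adjust \<open>E M\<close> while
    \<open>E i\<close> stays fixed.\<close>
  have single_add: "E i (\<lambda>l. w l + single k i x l) = E i w"
    if i: "i \<in> S" and w: "w \<in> W" and x: "x \<in> ?V" for i w x
  proof -
    have "E i (single k i x) = 0\<^sub>v n"
      using indep[OF i sW[OF i x] zW] E0 i by (simp add: single_def)
    then show ?thesis using add[of i w "single k i x"] i w sW[OF i x] carrier[of i w] by simp
  qed
  \<comment> \<open>If \<open>x\<close> and \<open>x'\<close> look alike to \<open>E i\<close>,
    crossed corrections at message \<open>i\<close> bring both values of \<open>E M\<close> to
    \<open>A j x + A j x'\<close>. Then \<open>dec1\<close> forces the corrections to agree, and
    with them \<open>x\<close> and \<open>x'\<close>.\<close>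
  have B_inj: "inj_on (\<lambda>x. E i (single k j x)) ?V" if i: "i \<in> S" and j: "j \<in> S" and "i \<noteq> j" for i j
  proof (rule inj_onI)
    fix x x' assume x: "x \<in> ?V" "x' \<in> ?V" "E i (single k j x) = E i (single k j x')"
    obtain y where y: "y \<in> ?V" "A i y = A j x'" using A_surj[OF i A[OF j x(2)]] by blast
    obtain y' where y': "y' \<in> ?V" "A i y' = A j x" using A_surj[OF i A[OF j x(1)]] by blast
    let ?w = "\<lambda>l. single k j x l + single k i y l" and ?w' = "\<lambda>l. single k j x' l + single k i y' l"
    have W: "?w \<in> W" "?w' \<in> W" using i j x y y' by (auto intro!: addW sW)
    have "E i ?w = E i ?w'"
      using i j x y y' by (simp add: single_add sW)
    moreover have "E M ?w = A j x + A j x'" "E M ?w' = A j x' + A j x"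
      using add[of M "single k j x" "single k i y"] add[of M "single k j x'" "single k i y'"]
        i j x y y' sW by (auto simp: A_def)
    then have "E M ?w = E M ?w'" using comm_add_vec[OF A[OF j x(1)] A[OF j x(2)]] by simp
    ultimately have "?w i = ?w' i" using dec1[OF i W] by blast
    then have "y = y'" using \<open>i \<noteq> j\<close> y y' k[OF i] by (simp add: single_def)
    then show "x = x'" using y y' x inj_onD[OF A_inj[OF j]] by metis
  qed
  define u where "u = vec n (\<lambda>_. 1 :: 'a)"
  have u: "u \<in> ?V" "u \<noteq> 0\<^sub>v n"
  proof -
    show "u \<in> ?V" by (simp add: u_def)
    have "u $ 0 \<noteq> 0\<^sub>v n $ 0" using n by (simp add: u_def)
    then show "u \<noteq> 0\<^sub>v n" by metis
  qed
  have "\<forall>j\<in>S. \<exists>x. x \<in> ?V \<and> A j x = u" using A_surj u(1) by blast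
  then obtain x where "\<forall>j\<in>S. x j \<in> ?V \<and> A j (x j) = u" by (rule bchoice[THEN exE])
  then have x: "\<And>j. j \<in> S \<Longrightarrow> x j \<in> ?V" "\<And>j. j \<in> S \<Longrightarrow> A j (x j) = u" by blast+
  define w where "w = (\<lambda>T i. if i \<in> T then x i else 0\<^sub>v (k i))"
  have wW: "w T \<in> W" if "T \<subseteq> S" for T using that x(1) k by (auto simp: w_def W_def)
  \<comment> \<open>Each message put into \<open>T\<close> adds one copy of \<open>u\<close>, which
    is how the cardinality enters the field.\<close>
  have EMw: "E M (w T) = of_nat (card T) \<cdot>\<^sub>v u" if "finite T" "T \<subseteq> S" for T
    using that
  proof (induction T)
    case empty
    then show ?case using E0[of M] u(1) by (auto simp: w_def)
  next
    case (insert j T)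
    have "w (insert j T) = (\<lambda>i. w T i + single k j (x j) i)"
      using insert x(1) k by (auto simp: w_def single_def fun_eq_iff)
    then have "E M (w (insert j T)) = E M (w T) + A j (x j)"
      using add[of M "w T" "single k j (x j)"] insert wW sW x(1) by (simp add: A_def)
    then show ?case
      using insert x(2) u(1) by (auto simp: add_smult_distrib_vec comm_add_vec)
  qed
  have EMS: "E M (w S) = u" using EMw[OF S(1)] one by simp
  have EiS: "E i (w S) = 0\<^sub>v n" if i: "i \<in> S" for i
  proof -
    \<comment> \<open>Here the block needs a second message.\<close>
    obtain j where j: "j \<in> S" "j \<noteq> i"
      using S by (metis card_le_Suc0_iff_eq not_less_eq_eq numeral_2_eq_2)
    have "(\<lambda>x. E i (single k j x)) ` ?V = ?V"
      using i j carrier sW B_inj[of i j] by (intro surj) auto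
    then obtain y where y: "y \<in> ?V" "E i (single k j y) = E i (w S)"
      using carrier[of i "w S"] i wW[of S] by (metis (no_types, lifting) imageE insertI2 order_refl)
    obtain y' where y': "y' \<in> ?V" "A i y' = u - A j y"
      using A_surj[OF i, of "u - A j y"] A[OF j(1) y(1)] u(1) by auto
    \<comment> \<open>\<open>?w\<close> involves only messages \<open>j\<close> and \<open>i\<close>
      but imitates \<open>w S\<close> in both \<open>E i\<close> and \<open>E M\<close>. Decoding
      gives \<open>y' = x i\<close>, so message \<open>i\<close> already supplies all of
      \<open>u\<close>, which leaves \<open>A j y = 0\<close> and hence
      \<open>y = 0\<close>.\<close>
    let ?w = "\<lambda>l. single k j y l + single k i y' l"
    have W: "?w \<in> W" using i j y y' by (auto intro!: addW sW)
    have "E i (w S) = E i ?w" using i j y y' by (simp add: single_add sW)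
    moreover have EMw2: "u = A j y + A i y'" using y'(2) A[OF j(1) y(1)] u(1) by auto
    then have "E M (w S) = E M ?w"
      using EMS add[of M "single k j y" "single k i y'"] i j y y' sW by (simp add: A_def)
    ultimately have "w S i = ?w i" using dec1[OF i wW W] by blast
    then have "x i = y'" using i j y y' k[OF i] by (simp add: single_def w_def)
    then have "u + A j y = u"
      using EMw2 x(2)[OF i] comm_add_vec[OF u(1) A[OF j(1) y(1)]] by simp
    then have "A j y = 0\<^sub>v n" by (rule eq_zero_vecI[OF u(1) A[OF j(1) y(1)]])
    then have "A j y = A j (0\<^sub>v n)" using A_zero[OF j(1)] by simp
    then have "y = 0\<^sub>v n" using inj_onD[OF A_inj[OF j(1)]] y(1) by (metis zero_carrier_vec)
    then have "E i (w S) = E i (single k j (0\<^sub>v n))" using y by simp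
    also have "single k j (0\<^sub>v n :: 'a vec) = (\<lambda>j. 0\<^sub>v (k j))"
      using k[OF j(1)] by (auto simp: single_def)
    finally show ?thesis using E0 i by simp
  qed
  obtain i where i: "i \<in> S" using S by fastforce
  have "w S i = 0\<^sub>v (k i)"
    using dec2[OF i wW zW] EiS E0 by simp
  then have "x i = 0\<^sub>v n" using i k by (simp add: w_def)
  then show False using x(2)[OF i] u(2) A_zero[OF i] by simp
qed

section \<open>The network\<close>

text \<open>The first component of a node is its layer, which increases along edges.  The edge
  \<open>arc (col i) (rel i)\<close> carries \<open>e\<^sub>i\<close>, and \<open>rel i\<close> only copies it, so that the nodes
  \<open>rcv i\<close> and \<open>blk (b i)\<close> see the same \<open>e\<^sub>i\<close>.  The block of message \<open>i\<close> is \<open>b i\<close>.\<close>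

abbreviation src :: "nat \<Rightarrow> nat" where "src j \<equiv> prod_encode (0, j)"
abbreviation col :: "nat \<Rightarrow> nat" where "col i \<equiv> prod_encode (Suc 0, i)"
abbreviation rel :: "nat \<Rightarrow> nat" where "rel i \<equiv> prod_encode (2, i)"
abbreviation rcv :: "nat \<Rightarrow> nat" where "rcv i \<equiv> prod_encode (3, i)"
abbreviation blk :: "nat \<Rightarrow> nat" where "blk c \<equiv> prod_encode (4, c)"
abbreviation arc :: "nat \<Rightarrow> nat \<Rightarrow> nat" where "arc u v \<equiv> prod_encode (u, v)"

text \<open>An edge is encoded as the pair of its ends. Index \<open>M\<close> is not a message, so
  \<open>{..<M} - {M}\<close> omits nothing and \<open>col M\<close> sees every message. Layer 3
  marks the receivers that demand a single message.\<close>

definition net :: "nat \<Rightarrow> (nat \<Rightarrow> nat) \<Rightarrow> (nat, nat) network" where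
  "net M b =
    \<lparr>graph =
      \<lparr>verts = src ` {..<M} \<union> col ` {..M} \<union> rel ` {..M} \<union> rcv ` {..<M} \<union> blk ` b ` {..<M},
       arcs = (\<Union>i\<le>M. (\<lambda>j. arc (src j) (col i)) ` ({..<M} - {i})) \<union>
         (\<lambda>i. arc (col i) (rel i)) ` {..M} \<union>
         (\<lambda>i. arc (rel i) (rcv i)) ` {..<M} \<union>
         (\<lambda>i. arc (rel M) (rcv i)) ` {..<M} \<union>
         (\<lambda>i. arc (rel i) (blk (b i))) ` {..<M},
       tail = fst \<circ> prod_decode,
       head = snd \<circ> prod_decode\<rparr>,
     sources = src ` {..<M},
     receivers = rcv ` {..<M} \<union> blk ` b ` {..<M},
     num_msgs = M,
     origin = src,
     demands = (\<lambda>v. case prod_decode v of (l, x) \<Rightarrow> if l = 3 then {x} else {i. i < M \<and> b i = x})\<rparr>"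

lemma net_simps [simp]:
  "sources (net M b) = src ` {..<M}"
  "receivers (net M b) = rcv ` {..<M} \<union> blk ` b ` {..<M}"
  "num_msgs (net M b) = M"
  "origin (net M b) = src"
  "tail (graph (net M b)) (arc u v) = u"
  "head (graph (net M b)) (arc u v) = v"
  "demands (net M b) (rcv i) = {i}"
  "demands (net M b) (blk c) = {i. i < M \<and> b i = c}"
  by (simp_all add: net_def)

lemma arcs_net:
  "arcs (graph (net M b)) = (\<Union>i\<le>M. (\<lambda>j. arc (src j) (col i)) ` ({..<M} - {i})) \<union>
     (\<lambda>i. arc (col i) (rel i)) ` {..M} \<union>
     (\<lambda>i. arc (rel i) (rcv i)) ` {..<M} \<union>
     (\<lambda>i. arc (rel M) (rcv i)) ` {..<M} \<union>
     (\<lambda>i. arc (rel i) (blk (b i))) ` {..<M}"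
  by (simp add: net_def)

lemma network_net: "network (net M b)"
proof (rule network.intro)
  show "fin_digraph (graph (net M b))"
    by unfold_locales (auto simp: net_def)
  have "arcs_ends (graph (net M b)) \<subseteq> measure (\<lambda>v. fst (prod_decode v))"
    by (auto simp: arcs_ends_def arc_to_ends_def arcs_net)
  then show "acyclic (arcs_ends (graph (net M b)))"
    by (rule acyclic_subset[OF wf_acyclic[OF wf_measure]])
  show "sources (net M b) \<subseteq> verts (graph (net M b))" "receivers (net M b) \<subseteq> verts (graph (net M b))"
    by (auto simp: net_def)
  show "demands (net M b) v \<subseteq> {..<num_msgs (net M b)}" if "v \<in> receivers (net M b)" for v
    using that by auto
qed simp

lemma arcs_into_net:
  "{e \<in> arcs (graph (net M b)). head (graph (net M b)) e = src j} = {}"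
  "i \<le> M \<Longrightarrow> {e \<in> arcs (graph (net M b)). head (graph (net M b)) e = col i} =
     (\<lambda>j. arc (src j) (col i)) ` ({..<M} - {i})"
  "i \<le> M \<Longrightarrow> {e \<in> arcs (graph (net M b)). head (graph (net M b)) e = rel i} = {arc (col i) (rel i)}"
  "i < M \<Longrightarrow> {e \<in> arcs (graph (net M b)). head (graph (net M b)) e = rcv i} =
     {arc (rel i) (rcv i), arc (rel M) (rcv i)}"
  "{e \<in> arcs (graph (net M b)). head (graph (net M b)) e = blk c} =
     (\<lambda>i. arc (rel i) (blk c)) ` {i. i < M \<and> b i = c}"
  by (auto simp: arcs_net)

lemma vec_sum_vec_1 [simp]: "vec_sum (vec (Suc 0) (\<lambda>_. s)) = s"
  by (simp add: vec_sum_def)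

section \<open>Achievability of a block rate by a scalar code\<close>

definition block_rate :: "nat \<Rightarrow> (nat \<Rightarrow> nat) \<Rightarrow> nat \<Rightarrow> rat vec" where
  "block_rate M b c = vec M (\<lambda>i. if b i = c then 1 else 0)"

text \<open>Every edge adds up its inputs. With \<open>s\<close> the sum of all messages,
  \<open>rcv i\<close> computes \<open>s - (s - x_i)\<close>, while \<open>blk c\<close> obtains
  \<open>s\<close> by dividing the sum of its inputs by |S| - 1 and then subtracts
  \<open>s - x_i\<close>. Messages outside block \<open>c\<close> are empty vectors.\<close>

definition block_code :: "nat \<Rightarrow> (nat \<Rightarrow> nat) \<Rightarrow> nat \<Rightarrow> (nat, nat, 'a::field) code" where
  "block_code M b c =
    \<lparr>msg_len = (\<lambda>i. if b i = c then 1 else 0),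
     edge_len = 1,
     edge_fun = (\<lambda>e. comb 1 (coefs (net M b) (tail (graph (net M b)) e) (\<lambda>_. 1))),
     dec_fun = (\<lambda>v i. comb (if b i = c then 1 else 0) (coefs (net M b) v (\<lambda>e.
       if v = rcv i then if e = arc (rel M) v then 1 else - 1
       else 1 / (of_nat (card {i. i < M \<and> b i = c}) - 1) - (if e = arc (rel i) v then 1 else 0))))\<rparr>"

lemma block_code_simps [simp]:
  "msg_len (block_code M b c) i = (if b i = c then 1 else 0)"
  "edge_len (block_code M b c) = 1"
  "edge_fun (block_code M b c :: (nat, nat, 'a::field) code) e =
    comb 1 (coefs (net M b) (tail (graph (net M b)) e) (\<lambda>_. 1))"
  by (simp_all add: block_code_def)

lemma is_linear_code_block_code: "is_linear_code (net M b) (block_code M b c)"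
  by (auto simp: is_linear_code_def is_code_def block_code_def coefs_def input_lens_def
      intro!: linear_on_comb)

lemma block_code_carries:
  fixes z :: "nat \<Rightarrow> 'a::field vec"
  assumes z: "carries (net M b) (block_code M b c) w z"
  shows "j < M \<Longrightarrow> i \<le> M \<Longrightarrow> j \<noteq> i \<Longrightarrow> vec_sum (z (arc (src j) (col i))) = vec_sum (w j)"
    and "i \<le> M \<Longrightarrow> vec_sum (z (arc (col i) (rel i))) = (\<Sum>j\<in>{..<M} - {i}. vec_sum (w j))"
    and "i \<le> M \<Longrightarrow> arc (rel i) v \<in> arcs (graph (net M b)) \<Longrightarrow>
      vec_sum (z (arc (rel i) v)) = (\<Sum>j\<in>{..<M} - {i}. vec_sum (w j))"
proof -
  \<comment> \<open>The recursion at one edge; the claims follow from it layer by layer, starting at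
    the sources.\<close>
  have *: "vec_sum (z (arc u v)) =
    (\<Sum>i | i < M \<and> src i = u. vec_sum (w i)) +
    (\<Sum>e | e \<in> arcs (graph (net M b)) \<and> head (graph (net M b)) e = u. vec_sum (z e))"
    if "arc u v \<in> arcs (graph (net M b))" for u v
  proof -
    have "z (arc u v) = comb 1 (coefs (net M b) u (\<lambda>_. 1)) (inputs (net M b) w z u)"
      using z that by (simp add: carries_def)
    then show ?thesis by (simp add: comb_coefs_inputs[OF network_net])
  qed
  have 1: "vec_sum (z (arc (src j) (col i))) = vec_sum (w j)"
    if "j < M" "i \<le> M" "j \<noteq> i" for i j
  proof -
    have "{l. l < M \<and> l = j} = {j}" using that by auto
    moreover have "arc (src j) (col i) \<in> arcs (graph (net M b))" using that by (auto simp: arcs_net)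
    ultimately show ?thesis by (simp add: * arcs_into_net)
  qed
  then show "j < M \<Longrightarrow> i \<le> M \<Longrightarrow> j \<noteq> i \<Longrightarrow> vec_sum (z (arc (src j) (col i))) = vec_sum (w j)" .
  have 2: "vec_sum (z (arc (col i) (rel i))) = (\<Sum>j\<in>{..<M} - {i}. vec_sum (w j))" if "i \<le> M" for i
  proof -
    have "arc (col i) (rel i) \<in> arcs (graph (net M b))" using that by (auto simp: arcs_net)
    then show ?thesis using that by (simp add: * arcs_into_net sum.reindex inj_on_def 1)
  qed
  then show "i \<le> M \<Longrightarrow> vec_sum (z (arc (col i) (rel i))) = (\<Sum>j\<in>{..<M} - {i}. vec_sum (w j))" .
  show "i \<le> M \<Longrightarrow> arc (rel i) v \<in> arcs (graph (net M b)) \<Longrightarrow>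
      vec_sum (z (arc (rel i) v)) = (\<Sum>j\<in>{..<M} - {i}. vec_sum (w j))"
    by (simp add: * arcs_into_net 2)
qed

lemma block_rate_achievable:
  assumes "(of_nat (card {i. i < M \<and> b i = c}) :: 'a::{field,finite}) \<noteq> 1"
  shows "block_rate M b c \<in> linear_rate_region (net M b) TYPE('a)"
proof -
  let ?N = "net M b" and ?S = "{i. i < M \<and> b i = c}"
  let ?C = "block_code M b c :: (nat, nat, 'a) code"
  have "dec_fun ?C v i (inputs ?N w z v) = w i"
    if w: "w \<in> messages ?N ?C" and z: "carries ?N ?C w z"
      and v: "v \<in> receivers ?N" and i: "i \<in> demands ?N v" for w z v i
  proof -
    define x where "x = (\<lambda>j. vec_sum (w j))"
    define s where "s = (\<Sum>j<M. x j)"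
    have iM: "i < M" using v i by auto
    have no_msgs: "{j. j < M \<and> src j = v} = {}" using v by auto
    have wdim: "dim_vec (w j) = (if b j = c then 1 else 0)" if "j < M" for j
      using w that by (auto simp: messages_def dest!: spec[of _ j])
    have s_minus: "(\<Sum>j\<in>{..<M} - {l}. vec_sum (w j)) = s - x l" if "l < M" for l
      using that by (simp add: s_def x_def sum_diff1)
    have relM: "vec_sum (z (arc (rel M) u)) = s" if "arc (rel M) u \<in> arcs (graph ?N)" for u
      using block_code_carries(3)[OF z _ that] by (simp add: s_def x_def)
    have rel: "vec_sum (z (arc (rel l) u)) = s - x l"
      if "l < M" "arc (rel l) u \<in> arcs (graph ?N)" for l u
      using block_code_carries(3)[OF z _ that(2)] that(1) by (simp add: s_minus)
    \<comment> \<open>Messages outside block \<open>c\<close> have length 0 and contribute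
      nothing.\<close>
    have s_S: "s = (\<Sum>j\<in>?S. x j)"
      unfolding s_def by (rule sum.mono_neutral_right) (auto simp: x_def vec_sum_def wdim)
    have "dec_fun ?C v i (inputs ?N w z v) = vec (if b i = c then 1 else 0) (\<lambda>_. x i)"
    proof (cases "v = rcv i \<or> b i \<noteq> c")
      case False
      then have v': "v = blk c" and bi: "b i = c" using v i by auto
      have arcs: "arc (rel j) (blk c) \<in> arcs (graph ?N)" if "j \<in> ?S" for j
        using that by (auto simp: arcs_net)
      let ?d = "of_nat (card ?S) - 1 :: 'a"
      have "(\<Sum>j\<in>?S. (1 / ?d - (if j = i then 1 else 0)) * (s - x j)) =
          (\<Sum>j\<in>?S. (s - x j) / ?d - (if j = i then s - x j else 0))"
        by (intro sum.cong) (auto simp: left_diff_distrib)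
      also have "\<dots> = (\<Sum>j\<in>?S. s - x j) / ?d - (\<Sum>j\<in>?S. if j = i then s - x j else 0)"
        by (subst sum_subtractf) (simp only: sum_divide_distrib)
      \<comment> \<open>There are |S| copies of \<open>s\<close>, and by \<open>s_S\<close> the
        \<open>x j\<close> together remove one.\<close>
      also have "(\<Sum>j\<in>?S. s - x j) = ?d * s"
        by (simp add: sum_subtractf s_S[symmetric] algebra_simps)
      also have "(\<Sum>j\<in>?S. if j = i then s - x j else 0) = s - x i"
        using iM bi by (subst sum.delta) auto
      finally have "(\<Sum>j\<in>?S. (1 / ?d - (if j = i then 1 else 0)) * (s - x j)) = x i"
        using assms by simp
      moreover have "dec_fun ?C v i (inputs ?N w z v) =
          vec 1 (\<lambda>_. \<Sum>j\<in>?S. (1 / ?d - (if j = i then 1 else 0)) * (s - x j))"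
        using no_msgs bi arcs by (auto simp: block_code_def comb_coefs_inputs[OF network_net] v'
            arcs_into_net sum.reindex inj_on_def rel intro!: eq_vecI sum.cong)
      ultimately show ?thesis using bi by simp
    next
      case True
      then consider "b i \<noteq> c" | "v = rcv i" by blast
      then show ?thesis
      proof cases
        case 1
        then show ?thesis by (auto simp: block_code_def comb_def)
      next
        case 2
        have "arc (rel i) (rcv i) \<in> arcs (graph ?N)" "arc (rel M) (rcv i) \<in> arcs (graph ?N)"
          using iM by (auto simp: arcs_net)
        then show ?thesis
          using no_msgs iM by (simp add: block_code_def comb_coefs_inputs[OF network_net] 2
              arcs_into_net rel relM)
      qed
    qed
    \<comment> \<open>A message of length 0 or 1 is recovered from its entry sum.\<close>
    also have "\<dots> = w i"
      using wdim[OF iM] by (intro eq_vecI) (auto simp: x_def vec_sum_def split: if_splits)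
    finally show ?thesis .
  qed
  moreover have "is_code ?N ?C" using is_linear_code_block_code by (auto simp: is_linear_code_def)
  ultimately have "is_solution ?N ?C" by (auto simp: is_solution_def)
  moreover have "rate_vector ?N ?C = block_rate M b c"
    by (auto simp: rate_vector_def block_rate_def)
  ultimately have "linearly_achievable ?N TYPE('a) (block_rate M b c)"
    unfolding linearly_achievable_def using is_linear_code_block_code by blast
  then show ?thesis by (simp add: linear_rate_region_def block_rate_def)
qed

section \<open>Necessity of the cardinality condition\<close>

lemma block_rate_achievableD:
  assumes card: "2 \<le> card {i. i < M \<and> b i = c}"
    and ach: "block_rate M b c \<in> linear_rate_region (net M b) TYPE('a::{field,finite})"
  shows "(of_nat (card {i. i < M \<and> b i = c}) :: 'a) \<noteq> 1"
proof -
  let ?N = "net M b" and ?S = "{i. i < M \<and> b i = c}"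
  obtain C :: "(nat, nat, 'a) code" where C: "is_linear_code ?N C" "is_solution ?N C"
    and rate: "rate_vector ?N C = block_rate M b c"
    using ach by (auto simp: linear_rate_region_def linearly_achievable_def)
  define k n where "k = msg_len C" and "n = edge_len C"
  have code: "is_code ?N C" using C by (simp add: is_linear_code_def)
  have n: "1 \<le> n" using code by (simp add: is_code_def n_def)
  have k: "k i = n" if "i \<in> ?S" for i
  proof -
    have "rate_vector ?N C $ i = 1" using rate that by (simp add: block_rate_def)
    then show ?thesis using that n by (simp add: rate_vector_def k_def n_def)
  qed
  define W where "W = {w :: nat \<Rightarrow> 'a vec. \<forall>i. w i \<in> carrier_vec (k i)}"
  have W: "w \<in> messages ?N C" if "w \<in> W" for w using that by (auto simp: W_def messages_def k_def)
  \<comment> \<open>On edges the choice is forced by \<open>carries_unique\<close>.\<close>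
  define Z where "Z = (\<lambda>w. SOME z. carries ?N C w z)"
  have Z: "carries ?N C w (Z w)" for w
    unfolding Z_def by (rule someI_ex[OF carries_exists[OF network_net]])
  have dec: "dec_fun C v i (inputs ?N w (Z w) v) = w i"
    if "w \<in> W" "v \<in> receivers ?N" "i \<in> demands ?N v" for w v i
    using C(2) W[OF that(1)] Z[of w] that(2,3) unfolding is_solution_def by blast
  \<comment> \<open>The vector entering \<open>rel i\<close> is the counterpart of
    \<open>e_i\<close> in an arbitrary solution.\<close>
  define E where "E = (\<lambda>i w. Z w (arc (col i) (rel i)))"
  have mid: "arc (col i) (rel i) \<in> arcs (graph ?N)" if "i \<le> M" for i
    using that by (auto simp: arcs_net)
  \<comment> \<open>The only input of \<open>rel i\<close> is \<open>E i\<close>, so everything it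
    sends on is a function of that one vector.\<close>
  have relay: "Z w (arc (rel i) v) = Z w' (arc (rel i) v)"
    if "i \<le> M" "arc (rel i) v \<in> arcs (graph ?N)" "E i w = E i w'" for i v w w'
  proof (rule carries_cong[OF network_net Z Z that(2)])
    fix e assume "e \<in> arcs (graph ?N)" "head (graph ?N) e = tail (graph ?N) (arc (rel i) v)"
    then have "e = arc (col i) (rel i)" using arcs_into_net(3)[OF that(1), of b] by auto
    then show "Z w e = Z w' e" using that(3) by (simp add: E_def)
  qed simp
  show ?thesis
  proof (rule card_ne_one_of_additive[where S = ?S and M = M and n = n and k = k and E = E])
    fix i and w :: "nat \<Rightarrow> 'a vec"
    assume "i \<in> insert M ?S" "w \<in> {w. \<forall>i. w i \<in> carrier_vec (k i)}"
    then show "E i w \<in> carrier_vec n"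
      unfolding E_def n_def by (intro carries_carrier[OF network_net code W Z] mid) (auto simp: W_def)
  next
    fix i and w w' :: "nat \<Rightarrow> 'a vec"
    assume i: "i \<in> insert M ?S" and
      w: "w \<in> {w. \<forall>i. w i \<in> carrier_vec (k i)}" "w' \<in> {w. \<forall>i. w i \<in> carrier_vec (k i)}"
    \<comment> \<open>Uniqueness identifies this sum with \<open>Z\<close> of the summed messages on
      every edge.\<close>
    have "carries ?N C (\<lambda>j. w j + w' j) (\<lambda>e. Z w e + Z w' e)"
      using w by (intro carries_add network_net C W Z) (auto simp: W_def)
    then show "E i (\<lambda>j. w j + w' j) = E i w + E i w'"
      unfolding E_def using carries_unique[OF network_net Z] mid i by auto
  next
    fix i and w w' :: "nat \<Rightarrow> 'a vec"
    assume i: "i \<in> ?S" and eq: "\<And>j. j \<noteq> i \<Longrightarrow> w j = w' j"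
    \<comment> \<open>No edge joins \<open>src i\<close> to \<open>col i\<close>, and an edge from
      \<open>src j\<close> depends only on message \<open>j\<close>.\<close>
    have "Z w e = Z w' e"
      if "e \<in> arcs (graph ?N)" "head (graph ?N) e = col i" for e
    proof -
      have "e \<in> {e \<in> arcs (graph ?N). head (graph ?N) e = col i}" using that by blast
      then obtain j where "e = arc (src j) (col i)" "j \<noteq> i"
        using i arcs_into_net(2)[of i M b] by fastforce
      then show ?thesis
        using eq arcs_into_net(1)[of M b j]
        by (intro carries_cong[OF network_net Z Z that(1), of w w']) auto
    qed
    then show "E i w = E i w'"
      unfolding E_def using i by (intro carries_cong[OF network_net Z Z mid]) auto
  next
    fix i and w w' :: "nat \<Rightarrow> 'a vec"
    assume i: "i \<in> ?S" and
      w: "w \<in> {w. \<forall>i. w i \<in> carrier_vec (k i)}" "w' \<in> {w. \<forall>i. w i \<in> carrier_vec (k i)}"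
      and E: "E i w = E i w'" "E M w = E M w'"
    have "inputs ?N w (Z w) (rcv i) = inputs ?N w' (Z w') (rcv i)"
    proof (rule inputs_cong[OF network_net])
      fix e assume e: "e \<in> arcs (graph ?N)" "head (graph ?N) e = rcv i"
      then have "e \<in> {e \<in> arcs (graph ?N). head (graph ?N) e = rcv i}" by blast
      then have "e = arc (rel i) (rcv i) \<or> e = arc (rel M) (rcv i)"
        using i arcs_into_net(4)[of i M b] by blast
      then show "Z w e = Z w' e" using relay[OF _ _ E(1)] relay[OF _ _ E(2)] e(1) i by auto
    qed auto
    then show "w i = w' i" using dec[of w "rcv i" i] dec[of w' "rcv i" i] i w by (simp add: W_def)
  next
    fix i and w w' :: "nat \<Rightarrow> 'a vec"
    assume i: "i \<in> ?S" and
      w: "w \<in> {w. \<forall>i. w i \<in> carrier_vec (k i)}" "w' \<in> {w. \<forall>i. w i \<in> carrier_vec (k i)}"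
      and E: "\<And>j. j \<in> ?S \<Longrightarrow> E j w = E j w'"
    have "inputs ?N w (Z w) (blk c) = inputs ?N w' (Z w') (blk c)"
    proof (rule inputs_cong[OF network_net])
      fix e assume e: "e \<in> arcs (graph ?N)" "head (graph ?N) e = blk c"
      then obtain j where j: "j \<in> ?S" "e = arc (rel j) (blk c)"
        using arcs_into_net(5)[of M b c] by blast
      then show "Z w e = Z w' e" using relay[OF _ _ E[OF j(1)]] e(1) by auto
    qed auto
    then show "w i = w' i" using dec[of w "blk c" i] dec[of w' "blk c" i] i w by (auto simp: W_def)
  qed (use card n k in auto)
qed

theorem theorem3p3:
  assumes "CHAR('f::{field,finite}) \<noteq> CHAR('k::{field,finite})"
  shows "\<exists>N :: (nat, nat) network. network N \<and>
    \<not> linear_rate_region N TYPE('f) \<subseteq> linear_rate_region N TYPE('k) \<and>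
    \<not> linear_rate_region N TYPE('k) \<subseteq> linear_rate_region N TYPE('f)"
proof -
  define p q where "p = CHAR('f)" and "q = CHAR('k)"
  have prime: "prime p" "prime q"
    unfolding p_def q_def by (auto intro!: prime_CHAR_semidom finite_imp_CHAR_pos)
  \<comment> \<open>The blocks \<open>{0..p}\<close> and \<open>{p+1..p+q+1}\<close> have p + 1 and
    q + 1 members, so |S| - 1 is p for the first and q for the second.\<close>
  define b where "b = (\<lambda>i. if i \<le> p then 0 else 1 :: nat)"
  let ?M = "p + q + 2"
  let ?N = "net ?M b"
  have "{i. i < ?M \<and> b i = 0} = {..p}" "{i. i < ?M \<and> b i = 1} = {p<..<?M}"
    by (auto simp: b_def)
  then have card: "card {i. i < ?M \<and> b i = 0} = p + 1" "card {i. i < ?M \<and> b i = 1} = q + 1"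
    by simp_all
  \<comment> \<open>Distinct primes do not divide each other, so each |S| - 1 vanishes in exactly
    one of the two fields.\<close>
  have "\<not> q dvd p" "\<not> p dvd q"
    using prime assms primes_dvd_imp_eq[of q p] primes_dvd_imp_eq[of p q]
    by (auto simp: p_def q_def)
  then have "(of_nat p :: 'k) \<noteq> 0" "(of_nat q :: 'f) \<noteq> 0" "(of_nat p :: 'f) = 0" "(of_nat q :: 'k) = 0"
    by (simp_all add: of_nat_eq_0_iff_char_dvd p_def q_def)
  then have "block_rate ?M b 0 \<in> linear_rate_region ?N TYPE('k)"
    "block_rate ?M b 1 \<in> linear_rate_region ?N TYPE('f)"
    "block_rate ?M b 0 \<notin> linear_rate_region ?N TYPE('f)"
    "block_rate ?M b 1 \<notin> linear_rate_region ?N TYPE('k)"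
    using card prime_ge_1_nat[OF prime(1)] prime_ge_1_nat[OF prime(2)]
      block_rate_achievable[of ?M b 0, where 'a = 'k] block_rate_achievable[of ?M b 1, where 'a = 'f]
      block_rate_achievableD[of ?M b 0, where 'a = 'f]
      block_rate_achievableD[of ?M b 1, where 'a = 'k]
    by auto
  then show ?thesis using network_net by blast
qed

end
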